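(* Let $V$ be a finite-dimensional $\square_q$-module. Then for every $i\in\mathbb{Z}_4$ the action of $\mathfrak{n}_{i,i+1}$ on $V$ is nilpotent.
   Context: Let $\mathbb{F}$ be an algebraically closed field and let $0\ne q\in\mathbb{F}$ be not a root of unity. Algebras are associative with $1$. $[3]_q=(q^3-q^{-3})/(q-q^{-1})$. Let $\mathbb{Z}_4=\mathbb{Z}/4\mathbb{Z}$; indices are taken in $\mathbb{Z}_4$. $\square_q$ is the $\mathbb{F}$-algebra with generators $\{x_i\}_{i\in\mathbb{Z}_4}$ and relations, for $i\in\mathbb{Z}_4$, $$\frac{qx_ix_{i+1}-q^{-1}x_{i+1}x_i}{q-q^{-1}}=1,\qquad x_i^3x_{i+2}-[3]_qx_i^2x_{i+2}x_i+[3]_qx_ix_{i+2}x_i^2-x_{i+2}x_i^3=0.$$ For $i\in\mathbb{Z}_4$ put $\mathfrak{n}_{i,i+1}=\dfrac{q(1-x_ix_{i+1})}{q-q^{-1}}=\dfrac{q^{-1}(1-x_{i+1}x_i)}{q-q^{-1}}\in\square_q$ (the two expressions agree by the first relation). A linear map $A$ is nilpotent if $A^n=0$ for some positive integer $n$. *)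

theory Defs
  imports
    "HOL-Computational_Algebra.Polynomial"
    "HOL-Library.Poly_Mapping"
    "HOL-Library.Numeral_Type"
    "HOL-Algebra.QuotRing"
begin

section \<open>Free associative algebras\<close>

text \<open>
  Words over an alphabet form a monoid under concatenation, written additively because
  \<^theory>\<open>HOL-Library.Poly_Mapping\<close> takes an additive monoid of exponents. The wrapper keeps the
  instance off the list type itself. The convolution product on finitely supported
  functions from words to \<open>'k\<close> then is the product of the free associative \<open>'k\<close>-algebra.
\<close>

datatype 'a free_word = Free_Word "'a list"

instantiation free_word :: (type) monoid_add
begin

definition zero_free_word :: "'a free_word" where
  "0 = Free_Word []"

fun plus_free_word :: "'a free_word \<Rightarrow> 'a free_word \<Rightarrow> 'a free_word" where
  "Free_Word u + Free_Word v = Free_Word (u @ v)"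

instance
proof
  fix a b c :: "'a free_word"
  show "a + b + c = a + (b + c)" by (cases a; cases b; cases c) simp
  show "0 + a = a" by (cases a) (simp add: zero_free_word_def)
  show "a + 0 = a" by (cases a) (simp add: zero_free_word_def)
qed

end

type_synonym ('g, 'k) free_alg = "'g free_word \<Rightarrow>\<^sub>0 'k"

definition free_gen :: "'g \<Rightarrow> ('g, 'k::field) free_alg" where
  "free_gen g = Poly_Mapping.single (Free_Word [g]) 1"

definition free_const :: "'k::field \<Rightarrow> ('g, 'k) free_alg" where
  "free_const c = Poly_Mapping.single 0 c"

definition free_algebra :: "('g, 'k::field) free_alg ring" where
  "free_algebra = \<lparr>carrier = UNIV, mult = (*), one = 1, zero = 0, add = (+)\<rparr>"

lemma ring_free_algebra: "ring (free_algebra :: ('g, 'k::field) free_alg ring)"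
  by unfold_locales
    (auto simp: free_algebra_def algebra_simps Units_def intro: exI [of _ "- x" for x])


section \<open>The algebra \<open>\<square>\<^sub>q\<close>\<close>

text \<open>
  The index set of the generators is the four-element type \<open>4\<close> of
  \<^theory>\<open>HOL-Library.Numeral_Type\<close>, whose arithmetic is arithmetic modulo 4.
\<close>

definition q_int :: "'k::field \<Rightarrow> nat \<Rightarrow> 'k" where
  "q_int q n = (q ^ n - inverse q ^ n) / (q - inverse q)"

definition box_relator1 :: "'k::field \<Rightarrow> 4 \<Rightarrow> (4, 'k) free_alg" where
  "box_relator1 q i = (let x = free_gen i; y = free_gen (i + 1) in
     free_const (1 / (q - inverse q)) * (free_const q * x * y - free_const (inverse q) * y * x) - 1)"

definition box_relator2 :: "'k::field \<Rightarrow> 4 \<Rightarrow> (4, 'k) free_alg" where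
  "box_relator2 q i = (let x = free_gen i; z = free_gen (i + 2); c = free_const (q_int q 3) in
     x ^ 3 * z - c * x ^ 2 * z * x + c * x * z * x ^ 2 - z * x ^ 3)"

definition box_ideal :: "'k::field \<Rightarrow> (4, 'k) free_alg set" where
  "box_ideal q = genideal free_algebra (range (box_relator1 q) \<union> range (box_relator2 q))"

definition box :: "'k::field \<Rightarrow> (4, 'k) free_alg set ring" where
  "box q = free_algebra Quot box_ideal q"

definition box_class :: "'k::field \<Rightarrow> (4, 'k) free_alg \<Rightarrow> (4, 'k) free_alg set" where
  "box_class q a = box_ideal q +>\<^bsub>free_algebra\<^esub> a"

definition box_gen :: "'k::field \<Rightarrow> 4 \<Rightarrow> (4, 'k) free_alg set" where
  "box_gen q i = box_class q (free_gen i)"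

definition box_const :: "'k::field \<Rightarrow> 'k \<Rightarrow> (4, 'k) free_alg set" where
  "box_const q c = box_class q (free_const c)"

definition box_nil :: "'k::field \<Rightarrow> 4 \<Rightarrow> (4, 'k) free_alg set" where
  "box_nil q i = box_const q (q / (q - inverse q)) \<otimes>\<^bsub>box q\<^esub>
     (\<one>\<^bsub>box q\<^esub> \<ominus>\<^bsub>box q\<^esub> box_gen q i \<otimes>\<^bsub>box q\<^esub> box_gen q (i + 1))"

lemma ideal_box_ideal: "ideal (box_ideal q) free_algebra"
  unfolding box_ideal_def
  by (rule ring.genideal_ideal [OF ring_free_algebra]) (simp add: free_algebra_def)

lemma ring_box: "ring (box q)"
  unfolding box_def by (rule ideal.quotient_is_ring [OF ideal_box_ideal])


lemma free_const_mult: "free_const (a * b) = free_const a * free_const b"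
  by (simp add: free_const_def mult_single)

lemma free_const_add: "free_const (a + b) = free_const a + free_const b"
  by (simp add: free_const_def single_add)

lemma free_const_1: "free_const 1 = 1"
  by (simp add: free_const_def)

lemma box_class_hom: "ring_hom_ring free_algebra (box q) (box_class q)"
  unfolding box_def box_class_def using ideal.rcos_ring_hom_ring [OF ideal_box_ideal] .

lemma box_class_in_carrier: "box_class q a \<in> carrier (box q)"
  using ring_hom_closed [OF ring_hom_ring.homh [OF box_class_hom]]
  by (simp add: free_algebra_def)

lemma box_class_add: "box_class q (a + b) = box_class q a \<oplus>\<^bsub>box q\<^esub> box_class q b"
  using ring_hom_add [OF ring_hom_ring.homh [OF box_class_hom]]
  by (simp add: free_algebra_def)

lemma box_class_mult: "box_class q (a * b) = box_class q a \<otimes>\<^bsub>box q\<^esub> box_class q b"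
  using ring_hom_mult [OF ring_hom_ring.homh [OF box_class_hom]]
  by (simp add: free_algebra_def)

lemma box_class_one: "box_class q 1 = \<one>\<^bsub>box q\<^esub>"
  using ring_hom_one [OF ring_hom_ring.homh [OF box_class_hom]]
  by (simp add: free_algebra_def)

lemma box_class_diff: "box_class q (a - b) = box_class q a \<ominus>\<^bsub>box q\<^esub> box_class q b"
proof -
  interpret ring "box q" by (rule ring_box)
  have "box_class q (a - b) \<oplus>\<^bsub>box q\<^esub> box_class q b = box_class q a"
    by (simp flip: box_class_add)
  then show ?thesis
    using box_class_in_carrier [of q "a - b"] box_class_in_carrier [of q a]
      box_class_in_carrier [of q b]
    by (metis a_minus_def a_assoc minus_closed r_neg r_zero add.inv_closed)
qed

lemma box_class_eqI:
  assumes "a - b \<in> box_ideal q"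
  shows "box_class q a = box_class q b"
proof -
  interpret ring "free_algebra :: (4, 'a) free_alg ring" by (rule ring_free_algebra)
  interpret ideal "box_ideal q" "free_algebra :: (4, 'a) free_alg ring" by (rule ideal_box_ideal)
  have "a = (a - b) + b" by simp
  then have "a \<in> box_class q b"
    using assms unfolding box_class_def a_r_coset_def' by (auto simp: free_algebra_def intro!: bexI [of _ "a - b"])
  then show ?thesis
    unfolding box_class_def
    by (intro a_repr_independence' [symmetric]) (auto simp: free_algebra_def)
qed

lemma box_relators_in_ideal: "box_relator1 q i \<in> box_ideal q" "box_relator2 q i \<in> box_ideal q"
  using ring.genideal_self [OF ring_free_algebra,
      of "range (box_relator1 q) \<union> range (box_relator2 q)"]
  unfolding box_ideal_def by (auto simp: free_algebra_def)

text \<open>The second expression for \<^const>\<open>box_nil\<close>.\<close>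

lemma box_nil_alt:
  fixes q :: "'a::field"
  assumes "q - inverse q \<noteq> 0"
  shows "box_nil q i = box_const q (inverse q / (q - inverse q)) \<otimes>\<^bsub>box q\<^esub>
     (\<one>\<^bsub>box q\<^esub> \<ominus>\<^bsub>box q\<^esub> box_gen q (i + 1) \<otimes>\<^bsub>box q\<^esub> box_gen q i)"
proof -
  let ?x = "free_gen i" and ?y = "free_gen (i + 1)"
  let ?d = "q - inverse q"
  have c: "(free_const (q / ?d) :: (4, 'a) free_alg) = 1 + free_const (inverse q / ?d)"
  proof -
    have "q / ?d = 1 + inverse q / ?d"
      using assms by (metis add_diff_cancel_left' add_divide_distrib diff_add_cancel divide_self)
    then show ?thesis
      by (simp add: free_const_add free_const_1)
  qed
  have "free_const (inverse q / ?d) * (1 - ?y * ?x) - free_const (q / ?d) * (1 - ?x * ?y)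
      = free_const (1 / ?d * q) * ?x * ?y - free_const (1 / ?d * inverse q) * ?y * ?x - 1"
    using c by (simp add: algebra_simps)
  also have "\<dots> = box_relator1 q i"
    unfolding box_relator1_def Let_def free_const_mult by (simp add: algebra_simps)
  finally have "box_class q (free_const (inverse q / ?d) * (1 - ?y * ?x))
      = box_class q (free_const (q / ?d) * (1 - ?x * ?y))"
    by (intro box_class_eqI) (simp add: box_relators_in_ideal)
  then show ?thesis
    by (simp add: box_nil_def box_const_def box_gen_def box_class_mult box_class_diff box_class_one)
qed


section \<open>Modules\<close>

text \<open>
  A left module over the \<open>'k\<close>-algebra \<^term>\<open>box q\<close>. The last axiom says that the
  vector space structure of the module is the one obtained by restricting the action to
  the scalars. Values of \<open>act\<close> outside the carrier are irrelevant.
\<close>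

locale box_module = vector_space scale
  for scale :: "'k::field \<Rightarrow> 'v::ab_group_add \<Rightarrow> 'v" +
  fixes q :: 'k
    and act :: "(4, 'k) free_alg set \<Rightarrow> 'v \<Rightarrow> 'v"
  assumes act_add_right:
      "a \<in> carrier (box q) \<Longrightarrow> act a (v + w) = act a v + act a w"
    and act_add_left:
      "a \<in> carrier (box q) \<Longrightarrow> b \<in> carrier (box q) \<Longrightarrow>
        act (a \<oplus>\<^bsub>box q\<^esub> b) v = act a v + act b v"
    and act_mult:
      "a \<in> carrier (box q) \<Longrightarrow> b \<in> carrier (box q) \<Longrightarrow>
        act (a \<otimes>\<^bsub>box q\<^esub> b) v = act a (act b v)"
    and act_one: "act \<one>\<^bsub>box q\<^esub> v = v"
    and act_const: "act (box_const q c) v = scale c v"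

definition nilpotent_map :: "('v::zero \<Rightarrow> 'v) \<Rightarrow> bool" where
  "nilpotent_map f \<longleftrightarrow> (\<exists>n>0. f ^^ n = (\<lambda>_. 0))"

end

theory Submission
  imports Defs
begin

text \<open>
  Fix \<open>i\<close> and let \<open>X\<close>, \<open>Y\<close>, \<open>N\<close> be the actions of \<open>x\<^sub>i\<close>, \<open>x\<^sub>i\<^sub>+\<^sub>1\<close> and \<open>\<nn>\<^sub>i\<^sub>,\<^sub>i\<^sub>+\<^sub>1\<close> on \<open>V\<close>. The two
  expressions for \<open>N\<close> say that \<open>XY = 1 - q\<^sup>-\<^sup>1(q - q\<^sup>-\<^sup>1)N\<close> and \<open>YX = 1 - q(q - q\<^sup>-\<^sup>1)N\<close>. Since
  \<open>X(1 - YX) = (1 - XY)X\<close>, and likewise with \<open>X\<close> and \<open>Y\<close> exchanged, \<open>NX = q\<^sup>2XN\<close> and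
  \<open>NY = q\<^sup>-\<^sup>2YN\<close>: the map \<open>X\<close> multiplies eigenvalues of \<open>N\<close> by \<open>q\<^sup>2\<close>, and \<open>Y\<close> divides them by
  \<open>q\<^sup>2\<close>.

  Suppose that \<open>N\<close> had an eigenvector \<open>v\<close> with eigenvalue \<open>\<theta> \<noteq> 0\<close>. Because \<open>q\<close> is not a root of
  unity, the scalars \<open>q\<^sup>2\<^sup>k\<theta>\<close> are pairwise distinct, so they cannot all be eigenvalues; hence the
  chain \<open>v, Xv, X\<^sup>2v, \<dots>\<close> has a last nonzero vector \<open>X\<^sup>kv\<close> (\<open>eigenvector_chain_ends\<close>), and so
  has \<open>v, Yv, Y\<^sup>2v, \<dots>\<close>, say \<open>Y\<^sup>mv\<close>. Evaluating \<open>YX\<close> at \<open>X\<^sup>kv\<close> and \<open>XY\<close> at \<open>Y\<^sup>mv\<close> gives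
  \[ q(q - q^{-1})\,q^{2k}\theta = 1 = q^{-1}(q - q^{-1})\,q^{-2m}\theta, \]
  whence \<open>q\<^sup>2\<^sup>(\<^sup>k\<^sup>+\<^sup>m\<^sup>+\<^sup>1\<^sup>) = 1\<close>, a contradiction (\<open>eigenvalue_zero\<close>). So \<open>0\<close> is the only possible
  eigenvalue of \<open>N\<close>, and over an algebraically closed field this forces nilpotency
  (\<open>nilpotent_if_only_eigenvalue_zero\<close>).
\<close>

section \<open>Polynomials in an endomorphism\<close>

locale endomorphism = vector_space scale
  for scale :: "'k::field \<Rightarrow> 'v::ab_group_add \<Rightarrow> 'v" (infixr \<open>*s\<close> 75) +
  fixes N :: "'v \<Rightarrow> 'v"
  assumes add: "N (v + w) = N v + N w"
    and scale: "N (c *s v) = c *s N v"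
begin

lemma zero: "N 0 = 0"
  using add [of 0 0] by simp

lemma diff: "N (v - w) = N v - N w"
  using add [of "v - w" w] by (simp add: algebra_simps)

text \<open>Horner evaluation, so that induction on the polynomial applies.\<close>

definition poly_apply :: "'k poly \<Rightarrow> 'v \<Rightarrow> 'v" where
  "poly_apply p = fold_coeffs (\<lambda>a f v. a *s v + N (f v)) p (\<lambda>_. 0)"

lemma poly_apply_0: "poly_apply 0 v = 0"
  by (simp add: poly_apply_def)

lemma poly_apply_pCons: "poly_apply (pCons a p) v = a *s v + N (poly_apply p v)"
  by (cases "p = 0"; cases "a = 0") (simp_all add: poly_apply_def zero)

lemma poly_apply_zero_right: "poly_apply p 0 = 0"
  by (induction p) (simp_all add: poly_apply_0 poly_apply_pCons zero)

lemma poly_apply_add_right: "poly_apply p (v + w) = poly_apply p v + poly_apply p w"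
  by (induction p) (simp_all add: poly_apply_0 poly_apply_pCons add algebra_simps)

lemma poly_apply_scale_right: "poly_apply p (c *s v) = c *s poly_apply p v"
  by (induction p) (simp_all add: poly_apply_0 poly_apply_pCons scale algebra_simps)

lemma poly_apply_commute: "poly_apply p (N v) = N (poly_apply p v)"
  by (induction p) (simp_all add: poly_apply_0 poly_apply_pCons zero add scale)

lemma poly_apply_add: "poly_apply (p + r) v = poly_apply p v + poly_apply r v"
proof (induction p r rule: poly_induct2)
  case (pCons a p b r)
  then show ?case
    by (simp add: poly_apply_pCons add algebra_simps)
qed (simp add: poly_apply_0)

lemma poly_apply_smult: "poly_apply (smult c p) v = c *s poly_apply p v"
  by (induction p) (simp_all add: poly_apply_0 poly_apply_pCons scale algebra_simps)

lemma poly_apply_mult: "poly_apply (p * r) v = poly_apply p (poly_apply r v)"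
  by (induction p)
    (simp_all add: poly_apply_0 poly_apply_pCons poly_apply_add poly_apply_smult)

lemma poly_apply_monom: "poly_apply (monom c n) v = c *s (N ^^ n) v"
  by (induction n)
    (simp_all add: monom_0 monom_Suc poly_apply_0 poly_apply_pCons zero scale)

lemma poly_apply_sum: "poly_apply (\<Sum>i\<in>I. f i) v = (\<Sum>i\<in>I. poly_apply (f i) v)"
  by (induction I rule: infinite_finite_induct) (simp_all add: poly_apply_0 poly_apply_add)

lemma poly_apply_eigenvector: "N v = \<theta> *s v \<Longrightarrow> poly_apply p v = poly p \<theta> *s v"
  by (induction p) (simp_all add: poly_apply_0 poly_apply_pCons scale algebra_simps)

text \<open>
  Each \<open>X\<^sup>kv\<close> that does not vanish is an eigenvector with eigenvalue \<open>c\<^sup>k\<theta>\<close>, hence a root of \<open>p\<close>.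
  As \<open>p\<close> has finitely many roots and the \<open>c\<^sup>k\<theta>\<close> are distinct, some \<open>X\<^sup>kv\<close> vanishes; the
  conclusion singles out the last vector before that happens.
\<close>

lemma eigenvector_chain_ends:
  assumes "p \<noteq> 0" and annihilates: "\<And>v. poly_apply p v = 0"
    and X: "endomorphism (*s) X"
    and q_commute: "\<And>v. N (X v) = c *s X (N v)"
    and c: "c \<noteq> 0" "\<And>n::nat. n > 0 \<Longrightarrow> c ^ n \<noteq> 1"
    and v: "N v = \<theta> *s v" "\<theta> \<noteq> 0" "v \<noteq> 0"
  obtains k w where "w \<noteq> 0" "X w = 0" "N w = (c ^ k * \<theta>) *s w"
proof -
  interpret X: endomorphism "(*s)" X
    by (rule X)
  have eigen: "N ((X ^^ k) v) = (c ^ k * \<theta>) *s (X ^^ k) v" for k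
    by (induction k) (simp_all add: v q_commute X.scale mult.assoc)
  have inj: "inj (\<lambda>k. c ^ k * \<theta>)"
  proof (rule linorder_injI)
    fix i j :: nat
    assume "i < j"
    then have "c ^ j = c ^ i * c ^ (j - i)"
      by (simp flip: power_add)
    with \<open>i < j\<close> c show "c ^ i * \<theta> \<noteq> c ^ j * \<theta>"
      using v(2) by simp
  qed
  have "\<exists>k. (X ^^ k) v = 0"
  proof (rule ccontr)
    assume nonzero: "\<nexists>k. (X ^^ k) v = 0"
    have "poly p (c ^ k * \<theta>) = 0" for k
      using poly_apply_eigenvector [OF eigen, of p k] annihilates nonzero by simp
    then have "range (\<lambda>k. c ^ k * \<theta>) \<subseteq> {x. poly p x = 0}"
      by auto
    then have "finite (range (\<lambda>k. c ^ k * \<theta>))"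
      using poly_roots_finite [OF \<open>p \<noteq> 0\<close>] by (rule finite_subset)
    with inj show False
      using finite_imageD by fastforce
  qed
  then obtain n where n: "(X ^^ n) v = 0" "\<And>k. k < n \<Longrightarrow> (X ^^ k) v \<noteq> 0"
    using exists_least_iff [of "\<lambda>n. (X ^^ n) v = 0"] by blast
  with v(3) obtain k where k: "n = Suc k"
    by (cases n) auto
  show thesis
    by (rule that [of "(X ^^ k) v" k]) (use n k eigen in auto)
qed

end

text \<open>
  Split a linear factor \<open>t - r\<close> off a polynomial annihilating \<open>v\<close>. If \<open>r \<noteq> 0\<close>, then \<open>N - r\<close> is
  injective and the factor may be cancelled; if \<open>r = 0\<close>, the remaining polynomial annihilates
  \<open>N v\<close>. So the degree of the polynomial bounds the power of \<open>N\<close> needed.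
\<close>

lemma funpow_degree_eq_zero:
  fixes p :: "'k::alg_closed_field poly" and N :: "'v::ab_group_add \<Rightarrow> 'v"
  assumes "endomorphism scale N"
    and eigenvalue_zero: "\<And>\<theta> v. N v = scale \<theta> v \<Longrightarrow> v \<noteq> 0 \<Longrightarrow> \<theta> = 0"
    and "p \<noteq> 0" "endomorphism.poly_apply scale N p v = 0"
  shows "(N ^^ degree p) v = 0"
  using assms(3,4)
proof (induction "degree p" arbitrary: p v)
  interpret endomorphism scale N
    by fact
  {
    case 0
    then obtain a where "p = [:a:]" "a \<noteq> 0"
      by (metis degree_eq_zeroE pCons_0_0)
    with 0 show ?case
      by (simp add: poly_apply_0 poly_apply_pCons zero)
  next
    case (Suc d)
    then obtain r where "poly p r = 0"
      using alg_closed_imp_poly_has_root [of p] by auto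
    then obtain s where p: "p = [:- r, 1:] * s"
      by (metis poly_eq_0_iff_dvd dvdE)
    with Suc.prems have s: "s \<noteq> 0"
      by auto
    then have "degree p = Suc (degree s)"
      unfolding p by (subst degree_mult_eq) auto
    with Suc.hyps(2) have deg: "degree p = Suc d" "degree s = d"
      by auto
    have N_s: "N (poly_apply s v) = scale r (poly_apply s v)"
      using Suc.prems(2) unfolding p poly_apply_mult
      by (simp add: poly_apply_pCons poly_apply_0 zero)
    have "poly_apply s (N v) = 0"
    proof (cases "r = 0")
      case True
      with N_s show ?thesis
        by (simp add: poly_apply_commute)
    next
      case False
      with N_s eigenvalue_zero have "poly_apply s v = 0"
        by blast
      then show ?thesis
        by (simp add: poly_apply_commute zero)
    qed
    with Suc.hyps(1) [of s "N v"] s deg have "(N ^^ d) (N v) = 0"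
      by simp
    then show ?case
      by (simp only: deg funpow_Suc_right o_apply)
  }
qed


section \<open>Endomorphisms of finite-dimensional spaces\<close>

locale finite_dimensional_endomorphism =
  finite_dimensional_vector_space scale Basis + endomorphism scale N
  for scale :: "'k::field \<Rightarrow> 'v::ab_group_add \<Rightarrow> 'v" (infixr \<open>*s\<close> 75)
    and Basis :: "'v set" and N :: "'v \<Rightarrow> 'v"
begin

text \<open>
  The vectors \<open>v, N v, \<dots>, N\<^sup>d v\<close> with \<open>d\<close> the dimension are one too many to be independent. A
  repetition among them is treated apart, as it does not show in the set of these vectors.
\<close>

lemma annihilating_poly_at:
  obtains p where "p \<noteq> 0" "poly_apply p v = 0"
proof -
  let ?f = "\<lambda>i. (N ^^ i) v"
  let ?I = "{..card Basis}"
  show thesis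
  proof (cases "inj_on ?f ?I")
    case False
    then obtain i j where ij: "i \<noteq> j" "?f i = ?f j"
      unfolding inj_on_def by auto
    have "coeff (monom 1 i + monom (- 1) j :: 'k poly) i \<noteq> 0"
      using ij by simp
    then have "monom 1 i + monom (- 1) j \<noteq> (0 :: 'k poly)"
      by (metis coeff_0)
    moreover have "poly_apply (monom 1 i + monom (- 1) j) v = 0"
      using ij by (simp add: poly_apply_add poly_apply_monom)
    ultimately show thesis
      by (rule that)
  next
    case True
    then have card: "card (?f ` ?I) = Suc (card Basis)"
      by (simp add: card_image)
    have "dependent (?f ` ?I)"
    proof (rule ccontr)
      assume "\<not> dependent (?f ` ?I)"
      from independent_span_bound [OF finite_Basis this] card show False
        by (simp add: span_Basis)
    qed
    then obtain u i where u: "i \<in> ?I" "u (?f i) \<noteq> 0" "(\<Sum>w\<in>?f ` ?I. u w *s w) = 0"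
      by (subst (asm) dependent_finite) auto
    define p where "p = (\<Sum>i\<in>?I. monom (u (?f i)) i)"
    have "coeff p i = u (?f i)"
      using u(1) by (simp add: p_def coeff_sum)
    with u(2) have "p \<noteq> 0"
      by auto
    moreover have "poly_apply p v = 0"
      using u(3) by (simp add: p_def poly_apply_sum poly_apply_monom sum.reindex [OF True])
    ultimately show thesis
      by (rule that)
  qed
qed

text \<open>
  Polynomials in \<open>N\<close> commute, so the product of polynomials that each annihilate one vector of
  a basis annihilates the whole basis.
\<close>

lemma annihilating_poly:
  obtains p where "p \<noteq> 0" "\<And>v. poly_apply p v = 0"
proof -
  have "\<exists>p. p \<noteq> 0 \<and> poly_apply p b = 0" for b
    by (rule annihilating_poly_at) blast
  then obtain P where P: "\<And>b. P b \<noteq> 0" "\<And>b. poly_apply (P b) b = 0"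
    by metis
  let ?p = "\<Prod>b\<in>Basis. P b"
  have on_Basis: "poly_apply ?p b = 0" if "b \<in> Basis" for b
  proof -
    have "?p = prod P (Basis - {b}) * P b"
      using prod.remove [OF finite_Basis that, of P] by (simp add: mult.commute)
    then show ?thesis
      by (simp add: poly_apply_mult P poly_apply_zero_right)
  qed
  have "poly_apply ?p v = 0" for v
  proof -
    have "v \<in> span Basis"
      by (simp add: span_Basis)
    then show ?thesis
      by (induction v rule: span_induct_alt)
        (simp_all add: poly_apply_zero_right poly_apply_add_right poly_apply_scale_right on_Basis)
  qed
  moreover have "?p \<noteq> 0"
    by (simp add: prod_zero_iff [OF finite_Basis] P)
  ultimately show thesis
    using that by blast
qed

end

lemma nilpotent_if_only_eigenvalue_zero:
  fixes scale :: "'k::alg_closed_field \<Rightarrow> 'v::ab_group_add \<Rightarrow> 'v"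
  assumes "finite_dimensional_endomorphism scale Basis N"
    and "\<And>\<theta> v. N v = scale \<theta> v \<Longrightarrow> v \<noteq> 0 \<Longrightarrow> \<theta> = 0"
  shows "nilpotent_map N"
proof -
  interpret finite_dimensional_endomorphism scale Basis N
    by fact
  obtain p where p: "p \<noteq> 0" "\<And>v. poly_apply p v = 0"
    using annihilating_poly by blast
  have "(N ^^ degree p) v = 0" for v
    using endomorphism_axioms assms(2) p by (rule funpow_degree_eq_zero)
  \<comment> \<open>one more power, as the exponent has to be positive even when \<open>V = 0\<close> and \<open>p\<close> is constant\<close>
  then have "N ^^ Suc (degree p) = (\<lambda>_. 0)"
    by (simp add: fun_eq_iff zero)
  then show ?thesis
    unfolding nilpotent_map_def by blast
qed


section \<open>The relation between two consecutive generators\<close>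

text \<open>
  The space carries linear maps \<open>X\<close> and \<open>Y\<close> with \<open>qXY - q\<^sup>-\<^sup>1YX = (q - q\<^sup>-\<^sup>1)1\<close>; this relation is
  encoded by the equality of the two expressions for \<open>N\<close>.
\<close>

locale q_weyl_pair =
  finite_dimensional_endomorphism scale Basis N +
  X: endomorphism scale X + Y: endomorphism scale Y
  for scale :: "'k::field \<Rightarrow> 'v::ab_group_add \<Rightarrow> 'v" (infixr \<open>*s\<close> 75)
    and Basis N X Y +
  fixes q :: 'k
  assumes q_nonzero: "q \<noteq> 0"
    and q_not_root_of_unity: "n > 0 \<Longrightarrow> q ^ n \<noteq> 1"
    and N_XY: "N v = (q / (q - inverse q)) *s (v - X (Y v))"
    and N_YX: "N v = (inverse q / (q - inverse q)) *s (v - Y (X v))"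
begin

lemma N_X: "N (X v) = q\<^sup>2 *s X (N v)"
proof -
  have "q\<^sup>2 * (inverse q / (q - inverse q)) = q / (q - inverse q)"
    using q_nonzero by (simp add: power2_eq_square)
  then show ?thesis
    by (simp only: N_XY [of "X v"] N_YX [of v] X.scale X.diff scale_scale)
qed

lemma N_Y: "N (Y v) = (inverse q)\<^sup>2 *s Y (N v)"
proof -
  have "(inverse q)\<^sup>2 * (q / (q - inverse q)) = inverse q / (q - inverse q)"
    using q_nonzero by (simp add: power2_eq_square)
  then show ?thesis
    by (simp only: N_YX [of "Y v"] N_XY [of v] Y.scale Y.diff scale_scale)
qed

lemma eigenvalue_zero:
  assumes v: "N v = \<theta> *s v" "v \<noteq> 0"
  shows "\<theta> = 0"
proof (rule ccontr)
  assume "\<theta> \<noteq> 0"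
  obtain p where p: "p \<noteq> 0" "\<And>v. poly_apply p v = 0"
    using annihilating_poly by blast
  have not_root: "(q\<^sup>2) ^ n \<noteq> 1" "((inverse q)\<^sup>2) ^ n \<noteq> 1" if "n > 0" for n
    using q_not_root_of_unity [of "2 * n"] that
    by (simp_all flip: power_mult add: power_inverse)
  obtain k w where w: "w \<noteq> 0" "X w = 0" "N w = ((q\<^sup>2) ^ k * \<theta>) *s w"
    using p X.endomorphism_axioms N_X _ not_root(1) v(1) \<open>\<theta> \<noteq> 0\<close> v(2)
    by (rule eigenvector_chain_ends) (use q_nonzero in simp)
  obtain m u where u: "u \<noteq> 0" "Y u = 0" "N u = (((inverse q)\<^sup>2) ^ m * \<theta>) *s u"
    using p Y.endomorphism_axioms N_Y _ not_root(2) v(1) \<open>\<theta> \<noteq> 0\<close> v(2)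
    by (rule eigenvector_chain_ends) (use q_nonzero in simp)
  have top: "(q\<^sup>2) ^ k * \<theta> = inverse q / (q - inverse q)"
    using w N_YX [of w] by (simp add: Y.zero)
  have bottom: "((inverse q)\<^sup>2) ^ m * \<theta> = q / (q - inverse q)"
    using u N_XY [of u] by (simp add: X.zero)
  have "\<theta> = (q\<^sup>2) ^ m * (q / (q - inverse q))"
    unfolding bottom [symmetric] using q_nonzero by (simp add: power_inverse)
  also have "q / (q - inverse q) = q\<^sup>2 * (inverse q / (q - inverse q))"
    using q_nonzero by (simp add: power2_eq_square)
  also have "\<dots> = q\<^sup>2 * ((q\<^sup>2) ^ k * \<theta>)"
    by (simp only: top)
  finally have "(q\<^sup>2) ^ (m + k + 1) * \<theta> = \<theta>"
    by (simp add: power_add mult_ac)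
  with \<open>\<theta> \<noteq> 0\<close> not_root(1) [of "m + k + 1"] show False
    by simp
qed

end


section \<open>The action of \<open>\<square>\<^sub>q\<close>\<close>

context box_module
begin

lemma act_diff:
  assumes "a \<in> carrier (box q)" "b \<in> carrier (box q)"
  shows "act (a \<ominus>\<^bsub>box q\<^esub> b) v = act a v - act b v"
proof -
  interpret R: ring "box q"
    by (rule ring_box)
  have "act ((a \<ominus>\<^bsub>box q\<^esub> b) \<oplus>\<^bsub>box q\<^esub> b) v = act (a \<ominus>\<^bsub>box q\<^esub> b) v + act b v"
    by (rule act_add_left) (use assms in auto)
  moreover have "(a \<ominus>\<^bsub>box q\<^esub> b) \<oplus>\<^bsub>box q\<^esub> b = a"
    using assms by (simp add: R.minus_eq R.a_assoc R.l_neg)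
  ultimately show ?thesis
    by simp
qed

text \<open>Scalars commute with the generators in the algebra and act as scalar multiplication.\<close>

lemma act_gen_scale: "act (box_gen q i) (scale c v) = scale c (act (box_gen q i) v)"
proof -
  have "free_gen i * free_const c = free_const c * free_gen i"
    by (simp add: free_gen_def free_const_def mult_single)
  then have "box_gen q i \<otimes>\<^bsub>box q\<^esub> box_const q c = box_const q c \<otimes>\<^bsub>box q\<^esub> box_gen q i"
    by (simp add: box_gen_def box_const_def flip: box_class_mult)
  then have "act (box_gen q i) (act (box_const q c) v) = act (box_const q c) (act (box_gen q i) v)"
    by (metis act_mult box_class_in_carrier box_const_def box_gen_def)
  then show ?thesis
    by (simp add: act_const)
qed

lemma endomorphism_act_gen: "endomorphism scale (act (box_gen q i))"
proof unfold_locales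
  have "box_gen q i \<in> carrier (box q)"
    by (simp add: box_gen_def box_class_in_carrier)
  then show "act (box_gen q i) (v + w) = act (box_gen q i) v + act (box_gen q i) w" for v w
    by (rule act_add_right)
qed (rule act_gen_scale)

lemma act_const_one_minus_gens:
  "act (box_const q c \<otimes>\<^bsub>box q\<^esub> (\<one>\<^bsub>box q\<^esub> \<ominus>\<^bsub>box q\<^esub> box_gen q i \<otimes>\<^bsub>box q\<^esub> box_gen q j)) v
    = scale c (v - act (box_gen q i) (act (box_gen q j) v))"
proof -
  interpret R: ring "box q"
    by (rule ring_box)
  have "box_const q a \<in> carrier (box q)" "box_gen q i \<in> carrier (box q)" for a i
    by (simp_all add: box_const_def box_gen_def box_class_in_carrier)
  then show ?thesis
    by (simp add: act_mult act_diff act_one act_const)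
qed

end

theorem proposition6p2:
  fixes q :: "'k::alg_closed_field"
    and scale :: "'k \<Rightarrow> 'v::ab_group_add \<Rightarrow> 'v"
    and Basis :: "'v set"
    and act :: "(4, 'k) free_alg set \<Rightarrow> 'v \<Rightarrow> 'v"
  assumes q_nonzero: "q \<noteq> 0"
    and q_not_root_of_unity: "\<And>n::nat. n > 0 \<Longrightarrow> q ^ n \<noteq> 1"
    and module: "box_module scale q act"
    and finite_dim: "finite_dimensional_vector_space scale Basis"
  shows "\<forall>i::4. nilpotent_map (act (box_nil q i))"
proof
  fix i :: 4
  interpret box_module scale q act
    by (rule module)
  interpret finite_dimensional_vector_space scale Basis
    by (rule finite_dim)
  let ?X = "act (box_gen q i)" and ?Y = "act (box_gen q (i + 1))" and ?N = "act (box_nil q i)"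
  interpret X: endomorphism scale ?X
    by (rule endomorphism_act_gen)
  interpret Y: endomorphism scale ?Y
    by (rule endomorphism_act_gen)
  have N_XY: "?N v = scale (q / (q - inverse q)) (v - ?X (?Y v))" for v
    unfolding box_nil_def by (rule act_const_one_minus_gens)
  have "q - inverse q \<noteq> 0"
  proof
    assume "q - inverse q = 0"
    then have "q ^ 2 = 1"
      using q_nonzero by (simp add: power2_eq_square field_simps)
    then show False
      using q_not_root_of_unity [of 2] by simp
  qed
  then have N_YX: "?N v = scale (inverse q / (q - inverse q)) (v - ?Y (?X v))" for v
    by (simp add: box_nil_alt act_const_one_minus_gens)
  interpret q_weyl_pair scale Basis ?N ?X ?Y q
  proof unfold_locales
    show "?N (v + w) = ?N v + ?N w" for v w
      by (simp only: N_XY X.add Y.add add_diff_add scale_right_distrib)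
    show "?N (scale c v) = scale c (?N v)" for c v
      by (simp add: N_XY X.scale Y.scale mult.commute flip: scale_right_diff_distrib)
  qed (fact q_nonzero q_not_root_of_unity N_XY N_YX)+
  show "nilpotent_map ?N"
    using finite_dimensional_endomorphism_axioms eigenvalue_zero
    by (rule nilpotent_if_only_eigenvalue_zero)
qed

end
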